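(* Let $f:M\to(N,g)$ be a pluri-harmonic map from a compact complex manifold $M$ to a Riemannian manifold $(N,g)$, and let $p\in M$. If the Riemannian curvature $R^g$ of $(N,g)$ is Hermitian non-degenerate at the point $f(p)$, then $\operatorname{rank}_{\mathbb R}df(p)\le 2$.
   Context: A smooth map $f:M\to(N,g)$ from a complex manifold to a Riemannian manifold is pluri-harmonic if, in local holomorphic coordinates $z^\alpha$ on $M$ and local coordinates on $N$, for all $\alpha,\beta,i$, $$\frac{\partial^2 f^i}{\partial z^\alpha\partial\bar z^\beta}+\Gamma^i_{jk}(f)\frac{\partial f^j}{\partial\bar z^\beta}\frac{\partial f^k}{\partial z^\alpha}=0,$$ where $\Gamma^i_{jk}$ are the Christoffel symbols of the Levi-Civita connection of $g$. Curvature convention: $R(X,Y,Z,W)=g(\nabla_X\nabla_YZ-\nabla_Y\nabla_XZ-\nabla_{[X,Y]}Z,W)$ with components $R_{ijk\ell}$. The curvature $R$ is Hermitian non-degenerate at a point $q\in N$ if, for every Hermitian positive semi-definite complex matrix $A=(A^{i\bar j})$, the equality $R_{ijk\ell}(q)A^{i\bar\ell}A^{j\bar k}=0$ implies that $A$ has complex rank $\le 1$. *)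

theory Defs
  imports "HOL-Analysis.Analysis"
begin

section \<open>Smooth and holomorphic maps between coordinate domains\<close>

text \<open>The differentiability notions below are only used on open sets.\<close>

fun Ck_on :: "nat \<Rightarrow> 'a::real_normed_vector set \<Rightarrow> ('a \<Rightarrow> 'b::real_normed_vector) \<Rightarrow> bool" where
  "Ck_on 0 S f \<longleftrightarrow> continuous_on S f"
| "Ck_on (Suc k) S f \<longleftrightarrow>
     (\<forall>x\<in>S. f differentiable (at x)) \<and> (\<forall>v. Ck_on k S (\<lambda>x. frechet_derivative f (at x) v))"

definition smooth_on :: "'a::real_normed_vector set \<Rightarrow> ('a \<Rightarrow> 'b::real_normed_vector) \<Rightarrow> bool" where
  "smooth_on S f \<longleftrightarrow> (\<forall>k. Ck_on k S f)"

definition holomorphic_map_on ::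
    "(complex^'m) set \<Rightarrow> (complex^'m \<Rightarrow> complex^'k) \<Rightarrow> bool" where
  "holomorphic_map_on S F \<longleftrightarrow>
     (\<forall>z\<in>S. \<exists>L. (F has_derivative L) (at z) \<and> (\<forall>c v. L (c *s v) = c *s L v))"


section \<open>Manifolds\<close>

text \<open>A chart is a pair of its domain and its coordinate map; only the values of the coordinate
  map on the domain matter.\<close>

type_synonym ('x, 'e) chart = "'x set \<times> ('x \<Rightarrow> 'e)"

definition is_chart :: "'x topology \<Rightarrow> ('x, 'e::euclidean_space) chart \<Rightarrow> bool" where
  "is_chart X = (\<lambda>(U, \<phi>). openin X U \<and> open (\<phi> ` U) \<and>
     homeomorphic_map (subtopology X U) (top_of_set (\<phi> ` U)) \<phi>)"

text \<open>The parameter \<open>reg\<close> is the regularity required of the coordinate changes.\<close>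

definition is_atlas ::
    "('e set \<Rightarrow> ('e \<Rightarrow> 'e) \<Rightarrow> bool) \<Rightarrow> 'x topology \<Rightarrow> ('x, 'e::euclidean_space) chart set \<Rightarrow> bool"
where
  "is_atlas reg X A \<longleftrightarrow>
     (\<forall>c\<in>A. is_chart X c) \<and> (\<Union>(U, \<phi>)\<in>A. U) = topspace X \<and>
     (\<forall>(U, \<phi>)\<in>A. \<forall>(V, \<psi>)\<in>A. reg (\<phi> ` (U \<inter> V)) (\<psi> \<circ> inv_into U \<phi>))"

definition complex_manifold :: "'x topology \<Rightarrow> ('x, complex^'m) chart set \<Rightarrow> bool" where
  "complex_manifold X A \<longleftrightarrow>
     Hausdorff_space X \<and> second_countable X \<and> is_atlas holomorphic_map_on X A"

definition smooth_manifold :: "'y topology \<Rightarrow> ('y, real^'n) chart set \<Rightarrow> bool" where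
  "smooth_manifold Y B \<longleftrightarrow>
     Hausdorff_space Y \<and> second_countable Y \<and> is_atlas smooth_on Y B"

definition coord_rep ::
    "('x, 'e) chart \<Rightarrow> ('y, 'f) chart \<Rightarrow> ('x \<Rightarrow> 'y) \<Rightarrow> 'e \<Rightarrow> 'f" where
  "coord_rep = (\<lambda>(U, \<phi>) (V, \<psi>) f. \<psi> \<circ> f \<circ> inv_into U \<phi>)"

definition coord_dom ::
    "('x, 'e) chart \<Rightarrow> ('y, 'f) chart \<Rightarrow> ('x \<Rightarrow> 'y) \<Rightarrow> 'e set" where
  "coord_dom = (\<lambda>(U, \<phi>) (V, \<psi>) f. \<phi> ` (U \<inter> f -` V))"

text \<open>Smooth maps; a complex manifold is regarded as a real manifold through the real normed
  space structure of \<open>complex^'m\<close>.\<close>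

definition smooth_map ::
    "'x topology \<Rightarrow> ('x, 'e::euclidean_space) chart set \<Rightarrow>
     'y topology \<Rightarrow> ('y, 'f::euclidean_space) chart set \<Rightarrow> ('x \<Rightarrow> 'y) \<Rightarrow> bool" where
  "smooth_map X A Y B f \<longleftrightarrow> continuous_map X Y f \<and>
     (\<forall>c\<in>A. \<forall>d\<in>B. smooth_on (coord_dom c d f) (coord_rep c d f))"

text \<open>The real rank of the differential at \<open>p\<close>, computed in charts \<open>c\<close> around \<open>p\<close> and \<open>d\<close>
  around \<open>f p\<close>.\<close>

definition rank_differential ::
    "('x, 'e::euclidean_space) chart \<Rightarrow> ('y, 'f::euclidean_space) chart \<Rightarrow>
     ('x \<Rightarrow> 'y) \<Rightarrow> 'x \<Rightarrow> nat" where
  "rank_differential c d f p =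
     dim (range (frechet_derivative (coord_rep c d f) (at (snd c p))))"


section \<open>Riemannian metrics, Levi-Civita connection and curvature\<close>

text \<open>A metric is given by its component matrices in the charts of the atlas: \<open>g d x $ i $ j\<close> is
  the component \<open>g\<^sub>i\<^sub>j\<close> in the chart \<open>d\<close>, at the point with coordinates \<open>x\<close>.  The last condition
  is the transformation law of a covariant tensor of degree 2.\<close>

type_synonym ('y, 'n) metric = "('y, real^'n) chart \<Rightarrow> real^'n \<Rightarrow> real^'n^'n"

definition riemannian_metric :: "('y, real^'n) chart set \<Rightarrow> ('y, 'n) metric \<Rightarrow> bool" where
  "riemannian_metric B g \<longleftrightarrow>
     (\<forall>(V, \<psi>)\<in>B. smooth_on (\<psi> ` V) (g (V, \<psi>)) \<and>
        (\<forall>x\<in>\<psi> ` V. transpose (g (V, \<psi>) x) = g (V, \<psi>) x \<and>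
           (\<forall>v. v \<noteq> 0 \<longrightarrow> v \<bullet> (g (V, \<psi>) x *v v) > 0))) \<and>
     (\<forall>(V, \<psi>)\<in>B. \<forall>(W, \<theta>)\<in>B. \<forall>q\<in>V \<inter> W.
        let J = matrix (frechet_derivative (\<theta> \<circ> inv_into V \<psi>) (at (\<psi> q)))
        in g (V, \<psi>) (\<psi> q) = transpose J ** g (W, \<theta>) (\<theta> q) ** J)"

definition riemannian_manifold ::
    "'y topology \<Rightarrow> ('y, real^'n) chart set \<Rightarrow> ('y, 'n) metric \<Rightarrow> bool" where
  "riemannian_manifold Y B g \<longleftrightarrow> smooth_manifold Y B \<and> riemannian_metric B g"

text \<open>From here on, \<open>G\<close> is the component matrix of the metric in one chart, as a function of the
  coordinates.  \<open>christoffel G i j k\<close> is \<open>\<Gamma>\<^sup>i\<^sub>j\<^sub>k\<close>.\<close>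

definition partial :: "'n \<Rightarrow> (real^'n \<Rightarrow> real) \<Rightarrow> real^'n \<Rightarrow> real" where
  "partial i h x = frechet_derivative h (at x) (axis i 1)"

definition christoffel ::
    "(real^'n \<Rightarrow> real^'n^'n) \<Rightarrow> 'n \<Rightarrow> 'n \<Rightarrow> 'n \<Rightarrow> real^'n \<Rightarrow> real" where
  "christoffel G i j k x = (1 / 2) * (\<Sum>l\<in>UNIV. matrix_inv (G x) $ i $ l *
     (partial j (\<lambda>y. G y $ k $ l) x + partial k (\<lambda>y. G y $ j $ l) x
        - partial l (\<lambda>y. G y $ j $ k) x))"

text \<open>Vector fields on a coordinate domain are identified with their component functions.\<close>

definition levi_civita ::
    "(real^'n \<Rightarrow> real^'n^'n) \<Rightarrow> (real^'n \<Rightarrow> real^'n) \<Rightarrow> (real^'n \<Rightarrow> real^'n) \<Rightarrow> real^'n \<Rightarrow> real^'n"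
where
  "levi_civita G X Z x = frechet_derivative Z (at x) (X x) +
     (\<chi> i. \<Sum>j\<in>UNIV. \<Sum>k\<in>UNIV. christoffel G i j k x * X x $ j * Z x $ k)"

definition lie_bracket ::
    "(real^'n \<Rightarrow> real^'n) \<Rightarrow> (real^'n \<Rightarrow> real^'n) \<Rightarrow> real^'n \<Rightarrow> real^'n" where
  "lie_bracket X Y x = frechet_derivative Y (at x) (X x) - frechet_derivative X (at x) (Y x)"

definition curvature ::
    "(real^'n \<Rightarrow> real^'n^'n) \<Rightarrow> (real^'n \<Rightarrow> real^'n) \<Rightarrow> (real^'n \<Rightarrow> real^'n) \<Rightarrow>
     (real^'n \<Rightarrow> real^'n) \<Rightarrow> (real^'n \<Rightarrow> real^'n) \<Rightarrow> real^'n \<Rightarrow> real" where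
  "curvature G X Y Z W x =
     (levi_civita G X (levi_civita G Y Z) x - levi_civita G Y (levi_civita G X Z) x
        - levi_civita G (lie_bracket X Y) Z x) \<bullet> (G x *v W x)"

definition curvature_comp ::
    "(real^'n \<Rightarrow> real^'n^'n) \<Rightarrow> 'n \<Rightarrow> 'n \<Rightarrow> 'n \<Rightarrow> 'n \<Rightarrow> real^'n \<Rightarrow> real" where
  "curvature_comp G i j k l =
     curvature G (\<lambda>_. axis i 1) (\<lambda>_. axis j 1) (\<lambda>_. axis k 1) (\<lambda>_. axis l 1)"


section \<open>Hermitian non-degenerate curvature\<close>

text \<open>The entry \<open>A $ i $ j\<close> is the component of \<open>A\<close> with first index \<open>i\<close> and second, barred,
  index \<open>j\<close>.  The quadratic form of a Hermitian matrix is real, hence equal to its real part.\<close>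

definition hermitian_psd :: "complex^'n^'n \<Rightarrow> bool" where
  "hermitian_psd A \<longleftrightarrow> (\<forall>i j. A $ i $ j = cnj (A $ j $ i)) \<and>
     (\<forall>v::complex^'n. Re (\<Sum>i\<in>UNIV. \<Sum>j\<in>UNIV. A $ i $ j * v $ i * cnj (v $ j)) \<ge> 0)"

definition hermitian_nondegenerate_at ::
    "('y, real^'n) chart set \<Rightarrow> ('y, 'n) metric \<Rightarrow> 'y \<Rightarrow> bool" where
  "hermitian_nondegenerate_at B g q \<longleftrightarrow>
     (\<forall>(V, \<psi>)\<in>B. q \<in> V \<longrightarrow>
       (\<forall>A::complex^'n^'n. hermitian_psd A \<longrightarrow>
         (\<Sum>i\<in>UNIV. \<Sum>j\<in>UNIV. \<Sum>k\<in>UNIV. \<Sum>l\<in>UNIV.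
            complex_of_real (curvature_comp (g (V, \<psi>)) i j k l (\<psi> q)) * A $ i $ l * A $ j $ k) = 0
         \<longrightarrow> rank A \<le> 1))"


section \<open>Pluri-harmonic maps\<close>

definition d_z :: "'m \<Rightarrow> (complex^'m \<Rightarrow> complex) \<Rightarrow> complex^'m \<Rightarrow> complex" where
  "d_z \<alpha> h z = (frechet_derivative h (at z) (axis \<alpha> 1)
     - \<i> * frechet_derivative h (at z) (axis \<alpha> \<i>)) / 2"

definition d_zbar :: "'m \<Rightarrow> (complex^'m \<Rightarrow> complex) \<Rightarrow> complex^'m \<Rightarrow> complex" where
  "d_zbar \<alpha> h z = (frechet_derivative h (at z) (axis \<alpha> 1)
     + \<i> * frechet_derivative h (at z) (axis \<alpha> \<i>)) / 2"

definition pluriharmonic ::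
    "'x topology \<Rightarrow> ('x, complex^'m) chart set \<Rightarrow>
     'y topology \<Rightarrow> ('y, real^'n) chart set \<Rightarrow> ('y, 'n) metric \<Rightarrow> ('x \<Rightarrow> 'y) \<Rightarrow> bool" where
  "pluriharmonic X A Y B g f \<longleftrightarrow> smooth_map X A Y B f \<and>
     (\<forall>c\<in>A. \<forall>d\<in>B.
        let F = (\<lambda>i z. complex_of_real (coord_rep c d f z $ i)) in
        \<forall>z\<in>coord_dom c d f. \<forall>\<alpha> \<beta> i.
          d_z \<alpha> (d_zbar \<beta> (F i)) z +
          (\<Sum>j\<in>UNIV. \<Sum>k\<in>UNIV. complex_of_real (christoffel (g d) i j k (coord_rep c d f z))
             * d_zbar \<beta> (F j) z * d_z \<alpha> (F k) z) = 0)"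

end

theory Submission
  imports Defs
begin

text \<open>In charts, write \<open>u\<close> for the map and \<open>u\<^sub>\<alpha> = \<partial>u/\<partial>z\<^sup>\<alpha>\<close>.  Pluri-harmonicity says that, for every
  \<open>\<gamma>\<close>, the conjugate \<open>cnj u\<^sub>\<gamma>\<close> is annihilated by the pulled-back Levi-Civita connection in all
  \<open>(1,0)\<close> directions.  As these directions commute, the curvature kills it:
  \<open>R(u\<^sub>\<alpha>, u\<^sub>\<beta>, cnj u\<^sub>\<gamma>, \<cdot>) = 0\<close>.  For \<open>P = (u\<^sup>i\<^sub>\<alpha>)\<close> and the Gram matrix \<open>A = P P\<^sup>*\<close>, the contraction of
  the curvature with \<open>A\<close> twice is \<open>\<Sum>\<gamma> \<delta>. R(u\<^sub>\<gamma>, u\<^sub>\<delta>, cnj u\<^sub>\<delta>, cnj u\<^sub>\<gamma>) = 0\<close>, so \<open>A\<close> has rank at most 1, and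
  hence so does \<open>P\<close>.  The image of the differential is then spanned by the real and the imaginary
  part of a single complex vector.\<close>

section \<open>Symmetry of second derivatives\<close>

lemma frechet_derivative_bounded_linear_compose:
  assumes "bounded_linear L" "f differentiable (at x)"
  shows "frechet_derivative (\<lambda>y. L (f y)) (at x) v = L (frechet_derivative f (at x) v)"
proof -
  have "((\<lambda>y. L (f y)) has_derivative (\<lambda>v. L (frechet_derivative f (at x) v))) (at x)"
    using assms bounded_linear.has_derivative frechet_derivative_works by blast
  then show ?thesis
    by (metis frechet_derivative_at)
qed

lemma frechet_derivative_add:
  assumes "f differentiable (at x)" "g differentiable (at x)"
  shows "frechet_derivative (\<lambda>y. f y + g y) (at x) v
    = frechet_derivative f (at x) v + frechet_derivative g (at x) v"
proof -
  have "((\<lambda>y. f y + g y) has_derivative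
      (\<lambda>v. frechet_derivative f (at x) v + frechet_derivative g (at x) v)) (at x)"
    using assms frechet_derivative_works has_derivative_add by blast
  then show ?thesis
    by (metis frechet_derivative_at)
qed

lemma differentiable_transform_open:
  assumes "f differentiable (at x)" "open S" "x \<in> S" "\<And>y. y \<in> S \<Longrightarrow> f y = g y"
  shows "g differentiable (at x)"
  using assms has_derivative_transform_within_open unfolding differentiable_def by blast

lemma Ck_on_Suc_imp_Ck_on:
  assumes "Ck_on (Suc k) S f"
  shows "Ck_on k S f"
  using assms
proof (induction k arbitrary: f)
  case 0
  then show ?case
    by (simp add: continuous_at_imp_continuous_on differentiable_imp_continuous_within)
next
  case (Suc k)
  then show ?case
    by (metis Ck_on.simps(2))
qed

text \<open>On an open set a derivative depends only on the values there, so the recursion in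
  \<open>Ck_on\<close> carries over from \<open>f\<close> to \<open>g\<close>. This allows a
  derivative to be replaced by the formula a differentiation rule gives for it on
  \<open>S\<close>.\<close>

lemma Ck_on_transform:
  assumes "open S" "Ck_on k S f" "\<And>x. x \<in> S \<Longrightarrow> f x = g x"
  shows "Ck_on k S g"
  using assms(2,3)
proof (induction k arbitrary: f g)
  case 0
  then show ?case
    using continuous_on_cong by force
next
  case (Suc k)
  have "g differentiable (at x)" if "x \<in> S" for x
    using that Suc.prems differentiable_transform_open[OF _ assms(1)] by (metis Ck_on.simps(2))
  moreover have "Ck_on k S (\<lambda>x. frechet_derivative g (at x) v)" for v
  proof (rule Suc.IH)
    show "Ck_on k S (\<lambda>x. frechet_derivative f (at x) v)"
      using Suc.prems by simp
    show "frechet_derivative f (at x) v = frechet_derivative g (at x) v" if "x \<in> S" for x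
      using that Suc.prems frechet_derivative_transform_within_open[OF _ assms(1)]
      by (metis Ck_on.simps(2))
  qed
  ultimately show ?case
    by simp
qed

lemma Ck_on_bounded_linear_compose:
  assumes "open S" "bounded_linear L" "Ck_on k S f"
  shows "Ck_on k S (\<lambda>x. L (f x))"
  using assms(3)
proof (induction k arbitrary: f)
  case 0
  then show ?case
    by (simp add: assms(2) bounded_linear.continuous_on)
next
  case (Suc k)
  have "(\<lambda>x. L (f x)) differentiable (at x)" if "x \<in> S" for x
    using that Suc.prems bounded_linear.has_derivative[OF assms(2)]
    unfolding Ck_on.simps differentiable_def by blast
  moreover have "Ck_on k S (\<lambda>x. frechet_derivative (\<lambda>y. L (f y)) (at x) v)" for v
  proof (rule Ck_on_transform[OF assms(1)])
    show "Ck_on k S (\<lambda>x. L (frechet_derivative f (at x) v))"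
      using Suc by simp
  qed (use Suc.prems in \<open>simp add: frechet_derivative_bounded_linear_compose[OF assms(2)]\<close>)
  ultimately show ?case
    by simp
qed

lemma Ck_on_add:
  assumes "open S" "Ck_on k S f" "Ck_on k S g"
  shows "Ck_on k S (\<lambda>x. f x + g x)"
  using assms(2,3)
proof (induction k arbitrary: f g)
  case 0
  then show ?case
    by (simp add: continuous_on_add)
next
  case (Suc k)
  have "Ck_on k S (\<lambda>x. frechet_derivative (\<lambda>y. f y + g y) (at x) v)" for v
  proof (rule Ck_on_transform[OF assms(1)])
    show "Ck_on k S (\<lambda>x. frechet_derivative f (at x) v + frechet_derivative g (at x) v)"
      using Suc by simp
  qed (use Suc.prems frechet_derivative_add in force)
  with Suc.prems show ?case
    by simp
qed

section \<open>Schwarz's theorem on mixed second derivatives\<close>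

text \<open>The mean value theorem is applied twice, first along \<open>v\<close> to a difference of
  values of \<open>f\<close>, then along \<open>w\<close> to the derivative of \<open>f\<close> in
  direction \<open>v\<close>. The second difference is symmetric in \<open>v\<close> and
  \<open>w\<close> while the derivative on the right is not a priori; this asymmetry is what gets
  exploited later.\<close>

lemma second_difference_mean_value:
  fixes f :: "'a::real_normed_vector \<Rightarrow> real"
  assumes C2: "Ck_on 2 S f" and t: "t > 0" and sub: "ball x r \<subseteq> S"
    and small: "t * (norm v + norm w) < r"
  obtains \<xi> where "dist x \<xi> \<le> t * (norm v + norm w)"
    "f (x + t *\<^sub>R v + t *\<^sub>R w) - f (x + t *\<^sub>R v) - f (x + t *\<^sub>R w) + f x
      = t\<^sup>2 * frechet_derivative (\<lambda>y. frechet_derivative f (at y) v) (at \<xi>) w"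
proof -
  \<comment> \<open>The whole parallelogram spanned by \<open>t *\<^sub>R v\<close> and
    \<open>t *\<^sub>R w\<close> at \<open>x\<close> stays within the required distance, so both
    mean value points will lie in \<open>S\<close>.\<close>
  have near: "dist x (x + s *\<^sub>R v + q *\<^sub>R w) \<le> t * (norm v + norm w)"
    if "0 \<le> s" "s \<le> t" "0 \<le> q" "q \<le> t" for s q
  proof -
    have "norm (s *\<^sub>R v + q *\<^sub>R w) \<le> s * norm v + q * norm w"
      using that by (metis norm_triangle_ineq norm_scaleR abs_of_nonneg)
    also have "\<dots> \<le> t * norm v + t * norm w"
      using that by (intro add_mono mult_right_mono) auto
    finally have "norm (s *\<^sub>R v + q *\<^sub>R w) \<le> t * (norm v + norm w)"
      by (simp add: algebra_simps)
    moreover have "dist x (x + s *\<^sub>R v + q *\<^sub>R w) = norm (s *\<^sub>R v + q *\<^sub>R w)"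
      by (metis add.assoc add_diff_cancel_left' dist_commute dist_norm)
    ultimately show ?thesis
      by simp
  qed
  have inS: "x + s *\<^sub>R v + q *\<^sub>R w \<in> S" if "0 \<le> s" "s \<le> t" "0 \<le> q" "q \<le> t" for s q
    using near[OF that] small sub by auto
  have df: "(f has_derivative frechet_derivative f (at y)) (at y)" if "y \<in> S" for y
    using C2 that by (simp add: numeral_2_eq_2 frechet_derivative_works)
  define h where "h = (\<lambda>y. frechet_derivative f (at y) v)"
  have dh: "(h has_derivative frechet_derivative h (at y)) (at y)" if "y \<in> S" for y
    using C2 that unfolding h_def by (simp add: numeral_2_eq_2 frechet_derivative_works[symmetric])
  have lin: "frechet_derivative k (at y) (c *\<^sub>R z) = c * frechet_derivative k (at y) z"
    if "(k has_derivative frechet_derivative k (at y)) (at y)" for k :: "'a \<Rightarrow> real" and y c z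
    using linear_scale[OF has_derivative_linear[OF that]] by simp
  \<comment> \<open>The increment of \<open>f\<close> along \<open>w\<close>, as a function of the
    position along \<open>v\<close>. The zero multiple of \<open>w\<close> is kept so that both
    terms are instances of one differentiation formula.\<close>
  define \<phi> where "\<phi> = (\<lambda>s. f (x + s *\<^sub>R v + t *\<^sub>R w) - f (x + s *\<^sub>R v + 0 *\<^sub>R w))"
  have d\<phi>: "(\<phi> has_derivative
      (\<lambda>c. c * (h (x + s *\<^sub>R v + t *\<^sub>R w) - h (x + s *\<^sub>R v + 0 *\<^sub>R w)))) (at s within {0..t})"
    if "0 \<le> s" "s \<le> t" for s
  proof -
    have "((\<lambda>s. f (x + s *\<^sub>R v + q *\<^sub>R w)) has_derivative
        (\<lambda>c. c * h (x + s *\<^sub>R v + q *\<^sub>R w))) (at s within {0..t})"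
      if "0 \<le> q" "q \<le> t" for q
    proof -
      have "((\<lambda>s. x + s *\<^sub>R v + q *\<^sub>R w) has_derivative (\<lambda>c. c *\<^sub>R v)) (at s within {0..t})"
        by (auto intro!: derivative_eq_intros)
      from has_derivative_compose[OF this df[OF inS]] that \<open>0 \<le> s\<close> \<open>s \<le> t\<close> show ?thesis
        using lin[OF df[OF inS]] by (simp add: h_def)
    qed
    from has_derivative_diff[OF this[of t] this[of 0]] t show ?thesis
      unfolding \<phi>_def by (simp add: algebra_simps)
  qed
  obtain s where s: "s \<in> {0..t}" and
    1: "\<phi> t - \<phi> 0 = t * (h (x + s *\<^sub>R v + t *\<^sub>R w) - h (x + s *\<^sub>R v + 0 *\<^sub>R w))"
    using mvt_very_simple[OF less_imp_le[OF t] d\<phi>] by auto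
  \<comment> \<open>With the first mean value point \<open>s\<close> frozen, the remaining
    difference of \<open>h\<close> is an increment along \<open>w\<close>.\<close>
  define \<psi> where "\<psi> = (\<lambda>q. h (x + s *\<^sub>R v + q *\<^sub>R w))"
  have d\<psi>: "(\<psi> has_derivative (\<lambda>c. c * frechet_derivative h (at (x + s *\<^sub>R v + q *\<^sub>R w)) w))
      (at q within {0..t})" if "0 \<le> q" "q \<le> t" for q
  proof -
    have "((\<lambda>q. x + s *\<^sub>R v + q *\<^sub>R w) has_derivative (\<lambda>c. c *\<^sub>R w)) (at q within {0..t})"
      by (auto intro!: derivative_eq_intros)
    from has_derivative_compose[OF this dh[OF inS]] that s show ?thesis
      using lin[OF dh[OF inS]] by (simp add: \<psi>_def)
  qed
  obtain q where q: "q \<in> {0..t}" and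
    2: "\<psi> t - \<psi> 0 = t * frechet_derivative h (at (x + s *\<^sub>R v + q *\<^sub>R w)) w"
    using mvt_very_simple[OF less_imp_le[OF t] d\<psi>] by auto
  have "f (x + t *\<^sub>R v + t *\<^sub>R w) - f (x + t *\<^sub>R v) - f (x + t *\<^sub>R w) + f x = \<phi> t - \<phi> 0"
    by (simp add: \<phi>_def)
  also have "\<dots> = t * (\<psi> t - \<psi> 0)"
    using 1 by (simp add: \<psi>_def)
  also have "\<dots> = t\<^sup>2 * frechet_derivative h (at (x + s *\<^sub>R v + q *\<^sub>R w)) w"
    using 2 by (simp add: power2_eq_square)
  finally show ?thesis
    using that[of "x + s *\<^sub>R v + q *\<^sub>R w"] near[of s q] s q by (auto simp: h_def)
qed

text \<open>Computing the same second difference in both orders gives equal values of the two mixed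
  derivatives at points \<open>\<xi>\<close> and \<open>\<eta>\<close> near \<open>x\<close>.
  Continuity of the mixed derivatives at \<open>x\<close> then makes their values there differ by
  less than any positive \<open>e\<close>.\<close>

lemma symmetric_second_derivative_real:
  fixes f :: "'a::real_normed_vector \<Rightarrow> real"
  assumes "open S" "x \<in> S" and C2: "Ck_on 2 S f"
  shows "frechet_derivative (\<lambda>y. frechet_derivative f (at y) v) (at x) w
    = frechet_derivative (\<lambda>y. frechet_derivative f (at y) w) (at x) v"
proof -
  define H where "H = (\<lambda>v w y. frechet_derivative (\<lambda>y. frechet_derivative f (at y) v) (at y) w)"
  have cont: "isCont (H v w) x" for v w
    using C2 assms(1,2) unfolding H_def
    by (simp add: numeral_2_eq_2 continuous_on_eq_continuous_at)
  obtain r where r: "r > 0" "ball x r \<subseteq> S"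
    using assms(1,2) open_contains_ball by blast
  have "dist (H v w x) (H w v x) \<le> 0 + e" if "e > 0" for e :: real
  proof -
    obtain d1 where d1: "d1 > 0" "\<And>y. dist x y < d1 \<Longrightarrow> dist (H v w x) (H v w y) < e/2"
      using cont[of v w] \<open>e > 0\<close> unfolding continuous_at_eps_delta
      by (metis dist_commute dist_norm half_gt_zero real_norm_def)
    obtain d2 where d2: "d2 > 0" "\<And>y. dist x y < d2 \<Longrightarrow> dist (H w v x) (H w v y) < e/2"
      using cont[of w v] \<open>e > 0\<close> unfolding continuous_at_eps_delta
      by (metis dist_commute dist_norm half_gt_zero real_norm_def)
    define m where "m = min r (min d1 d2)"
    \<comment> \<open>The summand 1 keeps the denominator positive when \<open>v\<close> and
      \<open>w\<close> both vanish, and makes the bound by \<open>m\<close> strict.\<close>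
    define t where "t = m / (norm v + norm w + 1)"
    have m: "m > 0" "m \<le> r" "m \<le> d1" "m \<le> d2"
      using r d1 d2 by (auto simp: m_def)
    have pos: "norm v + norm w + 1 > 0"
      by (meson add_nonneg_pos add_nonneg_nonneg norm_ge_zero zero_less_one)
    have t: "t > 0"
      using m pos by (simp add: t_def)
    have "t * (norm v + norm w) < t * (norm v + norm w + 1)"
      using t by simp
    also have "\<dots> = m"
      using pos by (simp add: t_def)
    finally have small: "t * (norm v + norm w) < m" .
    obtain \<xi> where \<xi>: "dist x \<xi> \<le> t * (norm v + norm w)"
      "f (x + t *\<^sub>R v + t *\<^sub>R w) - f (x + t *\<^sub>R v) - f (x + t *\<^sub>R w) + f x = t\<^sup>2 * H v w \<xi>"
      using second_difference_mean_value[OF C2 t r(2), of v w] small m unfolding H_def by auto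
    obtain \<eta> where \<eta>: "dist x \<eta> \<le> t * (norm w + norm v)"
      "f (x + t *\<^sub>R w + t *\<^sub>R v) - f (x + t *\<^sub>R w) - f (x + t *\<^sub>R v) + f x = t\<^sup>2 * H w v \<eta>"
      using second_difference_mean_value[OF C2 t r(2), of w v] small m
      unfolding H_def by (auto simp: add.commute)
    have "t\<^sup>2 * H v w \<xi> = t\<^sup>2 * H w v \<eta>"
      using \<xi>(2) \<eta>(2) by (simp add: algebra_simps)
    then have "H v w \<xi> = H w v \<eta>"
      using t by simp
    moreover have "dist (H v w x) (H v w \<xi>) < e/2"
      using d1(2) \<xi>(1) small m by force
    moreover have "dist (H w v x) (H w v \<eta>) < e/2"
      using d2(2) \<eta>(1) small m by (force simp: add.commute)
    ultimately show ?thesis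
      unfolding dist_real_def by linarith
  qed
  then have "dist (H v w x) (H w v x) \<le> 0"
    by (rule field_le_epsilon)
  then show ?thesis
    by (simp add: H_def)
qed

text \<open>Taking the inner product with a basis vector is bounded linear and commutes with both
  differentiations, which reduces the claim to real-valued functions.\<close>

lemma symmetric_second_derivative:
  fixes f :: "'a::real_normed_vector \<Rightarrow> 'b::euclidean_space"
  assumes "open S" "x \<in> S" and C2: "Ck_on 2 S f"
  shows "frechet_derivative (\<lambda>y. frechet_derivative f (at y) v) (at x) w
    = frechet_derivative (\<lambda>y. frechet_derivative f (at y) w) (at x) v"
proof (rule euclidean_eqI)
  fix b :: 'b
  have L: "bounded_linear (\<lambda>z. z \<bullet> b)"
    by (rule bounded_linear_inner_left)
  have d1: "f differentiable (at y)" if "y \<in> S" for y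
    using C2 that by (simp add: numeral_2_eq_2)
  have d2: "(\<lambda>y. frechet_derivative f (at y) v) differentiable (at x)" for v
    using C2 assms(2) by (simp add: numeral_2_eq_2)
  have d3: "(\<lambda>y. frechet_derivative f (at y) v \<bullet> b) differentiable (at x)" for v
    using d2[of v] bounded_linear.has_derivative[OF L] unfolding differentiable_def by blast
  have eq: "frechet_derivative (\<lambda>y. frechet_derivative f (at y) v) (at x) w \<bullet> b
      = frechet_derivative (\<lambda>y. frechet_derivative (\<lambda>y. f y \<bullet> b) (at y) v) (at x) w" for v w
  proof -
    have "frechet_derivative (\<lambda>y. frechet_derivative f (at y) v) (at x) w \<bullet> b
      = frechet_derivative (\<lambda>y. frechet_derivative f (at y) v \<bullet> b) (at x) w"
      using frechet_derivative_bounded_linear_compose[OF L d2] by simp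
    also have "\<dots> = frechet_derivative (\<lambda>y. frechet_derivative (\<lambda>y. f y \<bullet> b) (at y) v) (at x) w"
      using frechet_derivative_bounded_linear_compose[OF L d1]
      by (subst frechet_derivative_transform_within_open[OF d3 assms(1,2)]) auto
    finally show ?thesis .
  qed
  show "frechet_derivative (\<lambda>y. frechet_derivative f (at y) v) (at x) w \<bullet> b
    = frechet_derivative (\<lambda>y. frechet_derivative f (at y) w) (at x) v \<bullet> b"
    unfolding eq
    using symmetric_second_derivative_real[OF assms(1,2) Ck_on_bounded_linear_compose[OF assms(1) L C2]] .
qed


section \<open>Wirtinger derivatives\<close>

lemma d_z_transform:
  assumes "h differentiable (at z)" "open S" "z \<in> S" "\<And>y. y \<in> S \<Longrightarrow> h y = k y"
  shows "d_z \<alpha> h z = d_z \<alpha> k z"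
  unfolding d_z_def using frechet_derivative_transform_within_open[OF assms] by simp

lemma d_z_has_derivative:
  assumes "(h has_derivative h') (at z)"
  shows "d_z \<alpha> h z = (h' (axis \<alpha> 1) - \<i> * h' (axis \<alpha> \<i>)) / 2"
  unfolding d_z_def using frechet_derivative_at[OF assms] by simp

lemma d_z_mult:
  assumes "h differentiable (at z)" "k differentiable (at z)"
  shows "d_z \<alpha> (\<lambda>y. h y * k y) z = d_z \<alpha> h z * k z + h z * d_z \<alpha> k z"
proof -
  have *: "((\<lambda>y. h y * k y) has_derivative
     (\<lambda>v. h z * frechet_derivative k (at z) v + frechet_derivative h (at z) v * k z)) (at z)"
    using assms unfolding frechet_derivative_works by (rule has_derivative_mult)
  show ?thesis
    unfolding d_z_has_derivative[OF *]
    by (simp add: d_z_def field_simps)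
qed

lemma d_z_minus:
  assumes "h differentiable (at z)"
  shows "d_z \<alpha> (\<lambda>y. - h y) z = - d_z \<alpha> h z"
proof -
  have *: "((\<lambda>y. - h y) has_derivative (\<lambda>v. - frechet_derivative h (at z) v)) (at z)"
    using assms unfolding frechet_derivative_works by (rule has_derivative_minus)
  show ?thesis
    unfolding d_z_has_derivative[OF *]
    by (simp add: d_z_def field_simps)
qed

lemma d_z_sum:
  assumes "\<And>i. i \<in> I \<Longrightarrow> h i differentiable (at z)"
  shows "d_z \<alpha> (\<lambda>y. \<Sum>i\<in>I. h i y) z = (\<Sum>i\<in>I. d_z \<alpha> (h i) z)"
proof -
  have *: "((\<lambda>y. \<Sum>i\<in>I. h i y) has_derivative (\<lambda>v. \<Sum>i\<in>I. frechet_derivative (h i) (at z) v)) (at z)"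
    using assms unfolding frechet_derivative_works by (rule has_derivative_sum)
  show ?thesis
    unfolding d_z_has_derivative[OF *]
    by (simp add: d_z_def sum_divide_distrib sum_subtractf sum_distrib_left diff_divide_distrib)
qed

lemma frechet_derivative_partial_sum:
  fixes h :: "real^'n \<Rightarrow> real"
  assumes "h differentiable (at x)"
  shows "frechet_derivative h (at x) v = (\<Sum>l\<in>UNIV. partial l h x * v $ l)"
proof -
  have lin: "linear (frechet_derivative h (at x))"
    using assms by (rule linear_frechet_derivative)
  have "frechet_derivative h (at x) v = frechet_derivative h (at x) (\<Sum>l\<in>UNIV. v $ l *\<^sub>R axis l 1)"
    by (simp add: basis_expansion[of v, unfolded scalar_mult_eq_scaleR])
  also have "\<dots> = (\<Sum>l\<in>UNIV. v $ l *\<^sub>R frechet_derivative h (at x) (axis l 1))"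
    by (simp add: linear_sum[OF lin] linear_scale[OF lin])
  finally show ?thesis
    by (simp add: partial_def mult.commute)
qed

lemma d_z_component:
  fixes u :: "complex^'m \<Rightarrow> real^'n"
  assumes "(u has_derivative u') (at z)"
  shows "d_z \<alpha> (\<lambda>y. complex_of_real (u y $ i)) z
    = (complex_of_real (u' (axis \<alpha> 1) $ i) - \<i> * complex_of_real (u' (axis \<alpha> \<i>) $ i)) / 2"
proof -
  have "((\<lambda>y. complex_of_real (u y $ i)) has_derivative (\<lambda>v. complex_of_real (u' v $ i))) (at z)"
    using assms by (intro has_derivative_of_real bounded_linear.has_derivative[OF bounded_linear_vec_nth])
  then show ?thesis
    by (rule d_z_has_derivative)
qed

text \<open>Since \<open>u\<close> is real-valued, the real-linear derivative of \<open>h\<close>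
  extends complex-linearly to \<open>d_z\<close> of the components of \<open>u\<close>; no
  \<open>d_zbar\<close> terms arise.\<close>

lemma d_z_chain:
  fixes u :: "complex^'m \<Rightarrow> real^'n" and h :: "real^'n \<Rightarrow> real"
  assumes u: "u differentiable (at z)" and h: "h differentiable (at (u z))"
  shows "d_z \<alpha> (\<lambda>y. complex_of_real (h (u y))) z
    = (\<Sum>l\<in>UNIV. complex_of_real (partial l h (u z)) * d_z \<alpha> (\<lambda>y. complex_of_real (u y $ l)) z)"
proof -
  let ?u' = "frechet_derivative u (at z)"
  have u': "(u has_derivative ?u') (at z)"
    using u frechet_derivative_works by blast
  have *: "((\<lambda>y. complex_of_real (h (u y))) has_derivative
      (\<lambda>v. complex_of_real (frechet_derivative h (at (u z)) (?u' v)))) (at z)"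
    using has_derivative_compose[OF u'] h frechet_derivative_works
    by (intro has_derivative_of_real) blast
  show ?thesis
    unfolding d_z_has_derivative[OF *]
    by (simp add: frechet_derivative_partial_sum[OF h] d_z_component[OF u'] sum_divide_distrib
        sum_subtractf[symmetric] sum_distrib_left diff_divide_distrib algebra_simps)
qed

lemma Ck_on_d_z_d_zbar:
  assumes "open S" "Ck_on (Suc k) S h"
  shows "Ck_on k S (d_z \<alpha> h)" "Ck_on k S (d_zbar \<alpha> h)"
proof -
  have D: "Ck_on k S (\<lambda>z. c * frechet_derivative h (at z) v)" for c v
    by (rule Ck_on_bounded_linear_compose[OF assms(1) bounded_linear_mult_right])
      (use assms(2) in simp)
  show "Ck_on k S (d_z \<alpha> h)"
    by (rule Ck_on_transform[OF assms(1) Ck_on_add[OF assms(1)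
            D[of "1/2" "axis \<alpha> 1"] D[of "-\<i>/2" "axis \<alpha> \<i>"]]])
      (simp add: d_z_def field_simps)
  show "Ck_on k S (d_zbar \<alpha> h)"
    by (rule Ck_on_transform[OF assms(1) Ck_on_add[OF assms(1)
            D[of "1/2" "axis \<alpha> 1"] D[of "\<i>/2" "axis \<alpha> \<i>"]]])
      (simp add: d_zbar_def field_simps)
qed

text \<open>Each iterated Wirtinger derivative is a combination of four second derivatives in real
  directions, and each of these is symmetric in its two directions.\<close>

lemma d_z_commute:
  assumes "open S" "z \<in> S" "Ck_on 2 S h"
  shows "d_z \<alpha> (d_z \<beta> h) z = d_z \<beta> (d_z \<alpha> h) z"
proof -
  let ?D = "\<lambda>v w. frechet_derivative (\<lambda>y. frechet_derivative h (at y) v) (at z) w"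
  have "(\<lambda>y. frechet_derivative h (at y) v) differentiable (at z)" for v
    using assms by (simp add: numeral_2_eq_2)
  then have D: "((\<lambda>y. frechet_derivative h (at y) v) has_derivative ?D v) (at z)" for v
    using frechet_derivative_works by blast
  have dd: "d_z \<alpha> (d_z \<beta> h) z = (?D (axis \<beta> 1) (axis \<alpha> 1) - \<i> * ?D (axis \<beta> \<i>) (axis \<alpha> 1)
      - \<i> * (?D (axis \<beta> 1) (axis \<alpha> \<i>) - \<i> * ?D (axis \<beta> \<i>) (axis \<alpha> \<i>))) / 4" for \<alpha> \<beta>
  proof -
    have "((\<lambda>y. (1/2) * (frechet_derivative h (at y) (axis \<beta> 1)
          - \<i> * frechet_derivative h (at y) (axis \<beta> \<i>))) has_derivative
        (\<lambda>w. (1/2) * (?D (axis \<beta> 1) w - \<i> * ?D (axis \<beta> \<i>) w))) (at z)"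
      by (intro has_derivative_mult_right has_derivative_diff D)
    then have *: "(d_z \<beta> h has_derivative
        (\<lambda>w. (1/2) * (?D (axis \<beta> 1) w - \<i> * ?D (axis \<beta> \<i>) w))) (at z)"
      by (simp add: d_z_def[abs_def])
    show ?thesis
    unfolding d_z_has_derivative[OF *]
      by (simp add: field_simps)
  qed
  note sym = symmetric_second_derivative[OF assms]
  show ?thesis
    unfolding dd
    using sym[of "axis \<alpha> 1" "axis \<beta> 1"] sym[of "axis \<alpha> 1" "axis \<beta> \<i>"]
      sym[of "axis \<alpha> \<i>" "axis \<beta> 1"] sym[of "axis \<alpha> \<i>" "axis \<beta> \<i>"]
    by (simp add: algebra_simps)
qed

text \<open>The hypothesis \<open>parallel\<close> says that \<open>Z\<close> is annihilated by the pulled-back connection in all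
  \<open>(1,0)\<close> directions; the conclusion is the vanishing of the curvature of that connection on \<open>Z\<close>.\<close>

lemma parallel_field_curvature_zero:
  fixes u :: "complex^'m \<Rightarrow> real^'n" and \<Gamma> :: "'n \<Rightarrow> 'n \<Rightarrow> 'n \<Rightarrow> real^'n \<Rightarrow> real"
    and Z :: "'n \<Rightarrow> complex^'m \<Rightarrow> complex"
  defines "F \<equiv> \<lambda>i z. complex_of_real (u z $ i)"
  assumes S: "open S" "z \<in> S"
    and u: "u differentiable (at z)" and F2: "\<And>i. Ck_on 2 S (F i)" and Z2: "\<And>i. Ck_on 2 S (Z i)"
    and \<Gamma>: "\<And>i j k. \<Gamma> i j k differentiable (at (u z))"
    and parallel: "\<And>i \<alpha> y. y \<in> S \<Longrightarrow> d_z \<alpha> (Z i) y =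
      - (\<Sum>j\<in>UNIV. \<Sum>k\<in>UNIV. complex_of_real (\<Gamma> i j k (u y)) * d_z \<alpha> (F j) y * Z k y)"
  shows "(\<Sum>l\<in>UNIV. \<Sum>j\<in>UNIV. \<Sum>k\<in>UNIV.
      complex_of_real (partial l (\<Gamma> i j k) (u z) - partial j (\<Gamma> i l k) (u z)
        + (\<Sum>t\<in>UNIV. \<Gamma> i l t (u z) * \<Gamma> t j k (u z) - \<Gamma> i j t (u z) * \<Gamma> t l k (u z)))
      * d_z \<beta> (F l) z * d_z \<alpha> (F j) z * Z k z) = 0"
proof -
  let ?G = "\<lambda>i j k. complex_of_real (\<Gamma> i j k (u z))"
  let ?a = "\<lambda>\<alpha> j. d_z \<alpha> (F j) z"
  let ?d = "\<lambda>l i j k. complex_of_real (partial l (\<Gamma> i j k) (u z))"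
  have Zd: "Z i differentiable (at z)" for i
    using Z2 S by (simp add: numeral_2_eq_2)
  have dFd: "d_z \<alpha> (F j) differentiable (at z)" for \<alpha> j
    using Ck_on_d_z_d_zbar(1)[OF S(1), of 1 "F j" \<alpha>] F2 S by (simp add: numeral_2_eq_2)
  have dZd: "d_z \<alpha> (Z j) differentiable (at z)" for \<alpha> j
    using Ck_on_d_z_d_zbar(1)[OF S(1), of 1 "Z j" \<alpha>] Z2 S by (simp add: numeral_2_eq_2)
  have Gd: "(\<lambda>y. complex_of_real (\<Gamma> i j k (u y))) differentiable (at z)" for i j k
    using differentiable_chain_at[OF u \<Gamma>, of i j k]
    by (auto simp: o_def differentiable_def intro: has_derivative_of_real)
  \<comment> \<open>The product rule applied to the parallel equation yields three kinds of terms: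
    \<open>P\<close> differentiates the coefficients \<open>\<Gamma>\<close> along \<open>u\<close>,
    \<open>Q\<close> differentiates \<open>d_z \<alpha> (F j)\<close>, and \<open>W\<close> comes
    from differentiating \<open>Z\<close>.\<close>
  define P where "P = (\<lambda>\<alpha> \<beta>. \<Sum>j\<in>UNIV. \<Sum>k\<in>UNIV. \<Sum>l\<in>UNIV. ?d l i j k * ?a \<beta> l * ?a \<alpha> j * Z k z)"
  define Q where "Q = (\<lambda>\<alpha> \<beta>. \<Sum>j\<in>UNIV. \<Sum>k\<in>UNIV. ?G i j k * d_z \<beta> (d_z \<alpha> (F j)) z * Z k z)"
  define W where "W = (\<lambda>\<alpha> \<beta>. \<Sum>j\<in>UNIV. \<Sum>k\<in>UNIV. \<Sum>s\<in>UNIV. \<Sum>t\<in>UNIV.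
    ?G i j k * ?G k s t * ?a \<alpha> j * ?a \<beta> s * Z t z)"
  have dd: "d_z \<beta> (d_z \<alpha> (Z i)) z = - P \<alpha> \<beta> - Q \<alpha> \<beta> + W \<alpha> \<beta>" for \<alpha> \<beta>
  proof -
    have "d_z \<beta> (d_z \<alpha> (Z i)) z = d_z \<beta> (\<lambda>y. - (\<Sum>j\<in>UNIV. \<Sum>k\<in>UNIV.
        complex_of_real (\<Gamma> i j k (u y)) * d_z \<alpha> (F j) y * Z k y)) z"
      by (rule d_z_transform[OF dZd S parallel])
    also have "\<dots> = - (\<Sum>j\<in>UNIV. \<Sum>k\<in>UNIV.
        d_z \<beta> (\<lambda>y. complex_of_real (\<Gamma> i j k (u y)) * d_z \<alpha> (F j) y * Z k y) z)"
      using Gd dFd Zd by (simp add: d_z_minus d_z_sum)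
    also have "\<dots> = - (\<Sum>j\<in>UNIV. \<Sum>k\<in>UNIV.
        (\<Sum>l\<in>UNIV. ?d l i j k * ?a \<beta> l) * ?a \<alpha> j * Z k z
        + ?G i j k * d_z \<beta> (d_z \<alpha> (F j)) z * Z k z
        + ?G i j k * ?a \<alpha> j * d_z \<beta> (Z k) z)"
      using Gd dFd Zd by (simp add: d_z_mult d_z_chain[OF u \<Gamma>] F_def algebra_simps)
    also have "\<dots> = - P \<alpha> \<beta> - Q \<alpha> \<beta>
        + (\<Sum>j\<in>UNIV. \<Sum>k\<in>UNIV. - (?G i j k * ?a \<alpha> j * d_z \<beta> (Z k) z))"
      by (simp add: P_def Q_def sum.distrib sum_distrib_right sum_negf)
    \<comment> \<open>The parallel equation is used a second time, now for
      \<open>d_z \<beta> (Z k)\<close>; its minus sign cancels the one already present and produces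
      the terms quadratic in \<open>\<Gamma>\<close>.\<close>
    also have "(\<Sum>j\<in>UNIV. \<Sum>k\<in>UNIV. - (?G i j k * ?a \<alpha> j * d_z \<beta> (Z k) z)) = W \<alpha> \<beta>"
      unfolding W_def parallel[OF S(2)] by (simp add: sum_distrib_left mult_ac)
    finally show ?thesis .
  qed
  \<comment> \<open>Commuting second derivatives of \<open>F\<close> makes \<open>Q\<close>
    symmetric, so it drops out when the second derivatives of \<open>Z\<close> are commuted. The
    remaining antisymmetric part in \<open>P\<close> and \<open>W\<close> is the curvature
    expression.\<close>
  have "Q \<alpha> \<beta> = Q \<beta> \<alpha>"
    unfolding Q_def using d_z_commute[OF S F2] by simp
  with d_z_commute[OF S Z2, of \<alpha> \<beta> i] have PW: "P \<alpha> \<beta> - W \<alpha> \<beta> = P \<beta> \<alpha> - W \<beta> \<alpha>"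
    unfolding dd by (simp add: algebra_simps)
  have P1: "(\<Sum>l\<in>UNIV. \<Sum>j\<in>UNIV. \<Sum>k\<in>UNIV. ?d l i j k * ?a \<beta> l * ?a \<alpha> j * Z k z) = P \<alpha> \<beta>"
    unfolding P_def by (subst sum.swap, rule sum.cong[OF refl], rule sum.swap)
  have P2: "(\<Sum>l\<in>UNIV. \<Sum>j\<in>UNIV. \<Sum>k\<in>UNIV. ?d j i l k * ?a \<beta> l * ?a \<alpha> j * Z k z) = P \<beta> \<alpha>"
    unfolding P_def by (rule sum.cong[OF refl], subst sum.swap) (simp add: mult_ac)
  have W1: "(\<Sum>l\<in>UNIV. \<Sum>j\<in>UNIV. \<Sum>k\<in>UNIV. \<Sum>t\<in>UNIV.
      ?G i l t * ?G t j k * ?a \<beta> l * ?a \<alpha> j * Z k z) = W \<beta> \<alpha>"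
    unfolding W_def
    by (rule sum.cong[OF refl], subst sum.swap[of _ UNIV UNIV], subst (2) sum.swap)
      (rule refl)
  have W2: "(\<Sum>l\<in>UNIV. \<Sum>j\<in>UNIV. \<Sum>k\<in>UNIV. \<Sum>t\<in>UNIV.
      ?G i j t * ?G t l k * ?a \<beta> l * ?a \<alpha> j * Z k z) = W \<alpha> \<beta>"
    unfolding W_def
    by (subst sum.swap, rule sum.cong[OF refl], subst sum.swap[of _ UNIV UNIV], subst (2) sum.swap)
      (simp add: mult_ac)
  have "(\<Sum>l\<in>UNIV. \<Sum>j\<in>UNIV. \<Sum>k\<in>UNIV.
      complex_of_real (partial l (\<Gamma> i j k) (u z) - partial j (\<Gamma> i l k) (u z)
        + (\<Sum>t\<in>UNIV. \<Gamma> i l t (u z) * \<Gamma> t j k (u z) - \<Gamma> i j t (u z) * \<Gamma> t l k (u z)))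
      * d_z \<beta> (F l) z * d_z \<alpha> (F j) z * Z k z) = P \<alpha> \<beta> - P \<beta> \<alpha> + (W \<beta> \<alpha> - W \<alpha> \<beta>)"
    unfolding P1[symmetric] P2[symmetric] W1[symmetric] W2[symmetric]
    by (simp add: sum.distrib sum_subtractf algebra_simps sum_distrib_left sum_distrib_right)
  also have "\<dots> = 0"
    using PW by (simp add: algebra_simps)
  finally show ?thesis .
qed


section \<open>Gram matrices of rank one\<close>

text \<open>If row \<open>i\<close> is nonzero, row \<open>j\<close> must be a multiple of it, since
  otherwise the two rows would be independent and the row rank at least 2.\<close>

lemma minors_zero_of_rank_le_1:
  fixes A :: "'a::field^'n^'m"
  assumes "rank A \<le> 1"
  shows "A $ i $ k * A $ j $ l = A $ i $ l * A $ j $ k"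
proof (cases "row i A = 0")
  case True
  then have "A $ i $ k = 0" for k
    by (simp add: row_def vec_eq_iff)
  then show ?thesis
    by simp
next
  case False
  have "row j A \<in> vec.span {row i A}"
  proof (rule ccontr)
    assume notin: "row j A \<notin> vec.span {row i A}"
    then have "vec.independent {row j A, row i A}"
      using False by (intro vec.independent_insertI vec.independent_empty) auto
    moreover have "row j A \<noteq> row i A"
      using notin vec.span_base by blast
    ultimately have "card {row j A, row i A} \<le> vec.dim (rows A)"
      by (intro vec.independent_card_le_dim) (auto simp: rows_def)
    with \<open>row j A \<noteq> row i A\<close> assms show False
      by (simp add: row_rank_def_gen)
  qed
  then obtain c where "row j A = c *s row i A"
    by (auto simp: vec.span_singleton)
  then have "A $ j $ k = c * A $ i $ k" for k
    by (simp add: row_def vec_eq_iff)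
  then show ?thesis
    by simp
qed

text \<open>The quadratic form of a Gram matrix is the sum over \<open>\<gamma>\<close> of the
  squared moduli of \<open>\<Sum>i\<in>UNIV. P i \<gamma> * v $ i\<close>.\<close>

lemma hermitian_psd_gram:
  fixes P :: "'n::finite \<Rightarrow> 'm::finite \<Rightarrow> complex"
  shows "hermitian_psd (\<chi> i j. \<Sum>\<gamma>\<in>UNIV. P i \<gamma> * cnj (P j \<gamma>))"
proof -
  have eq: "(\<Sum>i\<in>UNIV. \<Sum>j\<in>UNIV. (\<Sum>\<gamma>\<in>UNIV. P i \<gamma> * cnj (P j \<gamma>)) * v $ i * cnj (v $ j))
      = (\<Sum>\<gamma>\<in>UNIV. (\<Sum>i\<in>UNIV. P i \<gamma> * v $ i) * cnj (\<Sum>i\<in>UNIV. P i \<gamma> * v $ i))"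
    (is "?l = ?r") for v :: "complex^'n"
  proof -
    have "?l = (\<Sum>i\<in>UNIV. \<Sum>\<gamma>\<in>UNIV. \<Sum>j\<in>UNIV. (P i \<gamma> * v $ i) * cnj (P j \<gamma> * v $ j))"
      by (subst (2) sum.swap) (simp add: sum_distrib_left sum_distrib_right mult_ac)
    also have "\<dots> = ?r"
      by (subst sum.swap) (simp add: sum_product)
    finally show ?thesis .
  qed
  have nonneg: "Re (\<Sum>\<gamma>\<in>UNIV. c \<gamma> * cnj (c \<gamma>)) \<ge> 0" for c :: "'m \<Rightarrow> complex"
    by (simp add: sum_nonneg)
  show ?thesis
    unfolding hermitian_psd_def vec_lambda_beta eq
    by (intro conjI allI nonneg) (simp add: mult.commute)
qed

text \<open>Equality in the Cauchy-Schwarz inequality makes any two rows of \<open>P\<close> proportional.\<close>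

lemma gram_rank_le_1_factor:
  fixes P :: "'n::finite \<Rightarrow> 'm::finite \<Rightarrow> complex"
  assumes "rank (\<chi> i j. \<Sum>\<gamma>\<in>UNIV. P i \<gamma> * cnj (P j \<gamma>) :: complex^'n^'n) \<le> 1"
  obtains c r where "\<And>i \<gamma>. P i \<gamma> = c i * r \<gamma>"
proof (cases "\<forall>i \<gamma>. P i \<gamma> = 0")
  case True
  then show ?thesis
    using that[of "\<lambda>_. 0"] by simp
next
  case False
  \<comment> \<open>A nonzero row \<open>o'\<close> serves as reference: every other row will be its
    multiple. \<open>H\<close> below is the Hermitian inner product of rows.\<close>
  then obtain o' \<gamma>0 where nz: "P o' \<gamma>0 \<noteq> 0"
    by blast
  define H where "H = (\<lambda>i j. \<Sum>\<gamma>\<in>UNIV. P i \<gamma> * cnj (P j \<gamma>))"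
  have minor: "H i o' * H o' i = H i i * H o' o'" for i
    using minors_zero_of_rank_le_1[OF assms, of i o' o' i] by (simp add: H_def)
  have H_real: "H i i = of_real (\<Sum>\<gamma>\<in>UNIV. (cmod (P i \<gamma>))\<^sup>2)" for i
    unfolding H_def of_real_sum complex_norm_square ..
  have "(\<Sum>\<gamma>\<in>UNIV. (cmod (P o' \<gamma>))\<^sup>2) > 0"
    by (rule sum_pos2[of _ \<gamma>0]) (use nz in auto)
  then have Hnz: "H o' o' \<noteq> 0"
    unfolding H_real by (metis of_real_eq_0_iff less_irrefl)
  have cH: "cnj (H i j) = H j i" for i j
    unfolding H_def by (simp add: mult.commute)
  have "P i \<gamma> * H o' o' = H i o' * P o' \<gamma>" for i \<gamma>
  proof -
    \<comment> \<open>Up to the factor \<open>H o' o'\<close>, this is row \<open>i\<close> minus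
      its orthogonal projection onto row \<open>o'\<close>. Its squared norm is a multiple of the
      vanishing minor.\<close>
    define D where "D = (\<lambda>\<gamma>. P i \<gamma> * H o' o' - H i o' * P o' \<gamma>)"
    \<comment> \<open>The expansion is stated for independent scalars; afterwards \<open>a\<close>
      becomes \<open>H o' o'\<close>, which equals its own conjugate, and \<open>b'\<close> becomes
      the conjugate \<open>H o' i\<close> of \<open>b\<close>, which is
      \<open>H i o'\<close>.\<close>
    have "(\<Sum>\<gamma>\<in>UNIV. (P i \<gamma> * a - b * P o' \<gamma>) * (cnj (P i \<gamma>) * a - b' * cnj (P o' \<gamma>)))
        = H i i * a * a - H i o' * a * b' - H o' i * a * b + H o' o' * b * b'" for a b b'
      unfolding H_def by (simp add: algebra_simps sum.distrib sum_subtractf sum_distrib_left)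
    then have "(\<Sum>\<gamma>\<in>UNIV. D \<gamma> * cnj (D \<gamma>)) = H i i * H o' o' * H o' o'
        - H i o' * H o' o' * H o' i - H o' i * H o' o' * H i o' + H o' o' * H i o' * H o' i"
      unfolding D_def complex_cnj_diff complex_cnj_mult cH .
    also have "\<dots> = 0"
      using minor[of i] by (simp add: algebra_simps)
    finally have "complex_of_real (\<Sum>\<gamma>\<in>UNIV. (cmod (D \<gamma>))\<^sup>2) = 0"
      by (simp only: of_real_sum complex_norm_square)
    then have "(\<Sum>\<gamma>\<in>UNIV. (cmod (D \<gamma>))\<^sup>2) = 0"
      by (metis of_real_eq_0_iff)
    then have "D \<gamma> = 0"
      by (simp add: sum_nonneg_eq_0_iff)
    then show ?thesis
      by (simp add: D_def)
  qed
  then show ?thesis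
    using that[of "\<lambda>i. H i o' / H o' o'" "P o'"] Hnz by (simp add: field_simps)
qed


section \<open>Curvature in terms of Christoffel symbols\<close>

lemma differentiable_vec_nth:
  fixes f :: "'a::real_normed_vector \<Rightarrow> ('b::euclidean_space)^'n"
  assumes "f differentiable (at x)"
  shows "(\<lambda>y. f y $ i) differentiable (at x)"
proof -
  obtain f' where "(f has_derivative f') (at x)"
    using assms unfolding differentiable_def by blast
  from bounded_linear.has_derivative[OF bounded_linear_vec_nth this] show ?thesis
    unfolding differentiable_def by blast
qed

lemma differentiable_prod:
  fixes f :: "'i \<Rightarrow> 'a::real_normed_vector \<Rightarrow> real"
  assumes "\<And>i. i \<in> I \<Longrightarrow> f i differentiable (at x)"
  shows "(\<lambda>y. \<Prod>i\<in>I. f i y) differentiable (at x)"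
  using assms
proof (induction I rule: infinite_finite_induct)
  case (insert i I)
  then have "(\<lambda>y. f i y * (\<Prod>i\<in>I. f i y)) differentiable (at x)"
    by (intro differentiable_mult) auto
  with insert.hyps show ?case
    by simp
qed simp_all

lemma differentiable_det:
  fixes M :: "'a::real_normed_vector \<Rightarrow> real^'n^'n"
  assumes "\<And>i j. (\<lambda>y. M y $ i $ j) differentiable (at x)"
  shows "(\<lambda>y. det (M y)) differentiable (at x)"
proof -
  have "(\<lambda>y. of_int (sign p) * (\<Prod>i\<in>UNIV. M y $ i $ p i)) differentiable (at x)" for p
    by (intro differentiable_mult differentiable_const differentiable_prod assms)
  then show ?thesis
    unfolding det_def by (intro differentiable_sum) auto
qed

text \<open>By Cramer's rule an entry of the inverse is a quotient of two determinants, each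
  polynomial in differentiable entries. Invertibility is assumed on a neighbourhood so that this
  formula may be differentiated.\<close>

lemma differentiable_matrix_inv:
  fixes M :: "'a::real_normed_vector \<Rightarrow> real^'n^'n"
  assumes M: "\<And>i j. (\<lambda>y. M y $ i $ j) differentiable (at x)"
    and S: "open S" "x \<in> S" and nz: "\<And>y. y \<in> S \<Longrightarrow> det (M y) \<noteq> 0"
  shows "(\<lambda>y. matrix_inv (M y) $ i $ j) differentiable (at x)"
proof (rule differentiable_transform_open[OF _ S])
  \<comment> \<open>Column \<open>j\<close> of the inverse solves the linear system with right-hand
    side \<open>axis j 1\<close>; its entry \<open>i\<close> needs column \<open>i\<close> of the
    matrix replaced by that right-hand side.\<close>
  let ?N = "\<lambda>y. \<chi> a b. if b = i then axis j 1 $ a else M y $ a $ b"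
  show "(\<lambda>y. det (?N y) / det (M y)) differentiable (at x)"
  proof (intro differentiable_divide differentiable_det)
    show "(\<lambda>y. ?N y $ a $ b) differentiable (at x)" for a b
      using M by (cases "b = i") simp_all
  qed (use M nz[OF S(2)] in auto)
  show "det (?N y) / det (M y) = matrix_inv (M y) $ i $ j" if "y \<in> S" for y
  proof -
    have "M y ** matrix_inv (M y) = mat 1"
      using nz[OF that] unfolding invertible_det_nz[symmetric] invertible_def matrix_inv_def
      by (rule someI2_ex) blast
    then have "M y *v (matrix_inv (M y) *v axis j 1) = axis j 1"
      by (simp add: matrix_vector_mul_assoc)
    then have "matrix_inv (M y) *v axis j 1
        = (\<chi> k. det (\<chi> a b. if b = k then axis j 1 $ a else M y $ a $ b) / det (M y))"
      using cramer[OF nz[OF that]] by blast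
    then have "(matrix_inv (M y) *v axis j 1) $ i = det (?N y) / det (M y)"
      by simp
    then show ?thesis
      by (simp add: matrix_vector_mult_basis column_def)
  qed
qed

lemma det_nonzero_of_positive_definite:
  fixes M :: "real^'n^'n"
  assumes "\<And>v. v \<noteq> 0 \<Longrightarrow> v \<bullet> (M *v v) > 0"
  shows "det M \<noteq> 0"
proof
  assume "det M = 0"
  then obtain v where "v \<noteq> 0" "M *v v = 0"
    by (metis invertible_det_nz matrix_left_invertible_ker invertible_left_inverse)
  with assms[of v] show False
    by simp
qed

text \<open>Two derivatives of the metric suffice: its first partials are then differentiable, and
  so are the entries of its inverse.\<close>

lemma differentiable_christoffel:
  assumes T: "open T" "x \<in> T" and G: "Ck_on 2 T G" and nz: "\<And>y. y \<in> T \<Longrightarrow> det (G y) \<noteq> 0"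
  shows "christoffel G i j k differentiable (at x)"
proof -
  have L: "bounded_linear (\<lambda>M::real^'n^'n. M $ a $ b)" for a b
    using bounded_linear_compose[OF bounded_linear_vec_nth bounded_linear_vec_nth] .
  note C2 = Ck_on_bounded_linear_compose[OF T(1) L G]
  have "(\<lambda>y. G y $ a $ b) differentiable (at x)" for a b
    using C2[of a b] T(2) by (simp add: numeral_2_eq_2)
  then have I: "(\<lambda>y. matrix_inv (G y) $ a $ b) differentiable (at x)" for a b
    by (rule differentiable_matrix_inv[OF _ T nz])
  have P: "partial l (\<lambda>y. G y $ a $ b) differentiable (at x)" for l a b
    using C2[of a b] T(2) by (simp add: numeral_2_eq_2 partial_def[abs_def])
  have "(\<lambda>y. matrix_inv (G y) $ i $ l * (partial j (\<lambda>y. G y $ k $ l) y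
      + partial k (\<lambda>y. G y $ j $ l) y - partial l (\<lambda>y. G y $ j $ k) y)) differentiable (at x)" for l
    by (rule differentiable_mult[OF I differentiable_diff[OF differentiable_add[OF P P] P]])
  then have "(\<lambda>y. (1/2) * (\<Sum>l\<in>UNIV. matrix_inv (G y) $ i $ l * (partial j (\<lambda>y. G y $ k $ l) y
      + partial k (\<lambda>y. G y $ j $ l) y - partial l (\<lambda>y. G y $ j $ k) y))) differentiable (at x)"
    by (intro differentiable_mult[OF differentiable_const] differentiable_sum) auto
  then show ?thesis
    by (simp add: christoffel_def[abs_def])
qed

text \<open>This is the torsion-freeness of the connection. Symmetry of the metric is required on a
  neighbourhood because it is used under a partial derivative.\<close>

lemma christoffel_commute:
  assumes T: "open T" "x \<in> T" and G: "Ck_on 1 T G" and sym: "\<And>y. y \<in> T \<Longrightarrow> transpose (G y) = G y"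
  shows "christoffel G i j k x = christoffel G i k j x"
proof -
  have d: "(\<lambda>y. G y $ a $ b) differentiable (at x)" for a b
    using G T(2) by (simp add: differentiable_vec_nth)
  have "G y $ a $ b = G y $ b $ a" if "y \<in> T" for a b y
    using sym[OF that] by (metis transpose_def vec_lambda_beta)
  then have "partial l (\<lambda>y. G y $ j $ k) x = partial l (\<lambda>y. G y $ k $ j) x" for l
    unfolding partial_def using frechet_derivative_transform_within_open[OF d T] by metis
  then show ?thesis
    unfolding christoffel_def by (simp add: add.commute)
qed

text \<open>Covariant derivatives of coordinate fields have the Christoffel symbols as components,
  and coordinate fields commute. Two covariant derivatives thus give the classical formula, whose
  upper index \<open>s\<close> is lowered by the metric.\<close>

lemma curvature_comp_eq:
  fixes G :: "real^'n \<Rightarrow> real^'n^'n"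
  assumes d: "\<And>i j k. christoffel G i j k differentiable (at x)"
  shows "curvature_comp G i j k l x = (\<Sum>s\<in>UNIV. (partial i (christoffel G s j k) x
      - partial j (christoffel G s i k) x
      + (\<Sum>t\<in>UNIV. christoffel G s i t x * christoffel G t j k x
          - christoffel G s j t x * christoffel G t i k x)) * G x $ s $ l)"
proof -
  have nabla: "levi_civita G (\<lambda>_. axis a 1) (\<lambda>_. axis b 1) = (\<lambda>y. \<chi> s. christoffel G s a b y)" for a b
    by (rule ext) (simp add: levi_civita_def vec_eq_iff axis_def if_distrib[of "\<lambda>t. _ * t"] cong: if_cong)
  have der: "frechet_derivative (\<lambda>y. \<chi> s. christoffel G s a b y) (at x) (axis c 1)
      = (\<chi> s. partial c (christoffel G s a b) x)" for a b c
  proof -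
    have "((\<lambda>y. \<chi> s. christoffel G s a b y) has_derivative
        (\<lambda>v. \<chi> s. frechet_derivative (christoffel G s a b) (at x) v)) (at x)"
      unfolding has_derivative_componentwise_within[of "\<lambda>y. \<chi> s. _ s y"]
      using d by (auto simp: Basis_vec_def inner_axis frechet_derivative_works)
    from frechet_derivative_at[OF this, symmetric] show ?thesis
      by (simp add: partial_def)
  qed
  have nabla2: "levi_civita G (\<lambda>_. axis c 1) (\<lambda>y. \<chi> s. christoffel G s a b y) x
      = (\<chi> s. partial c (christoffel G s a b) x
          + (\<Sum>t\<in>UNIV. christoffel G s c t x * christoffel G t a b x))" for a b c
    unfolding levi_civita_def der
    by (subst sum.swap) (simp add: vec_eq_iff axis_def if_distrib[of "\<lambda>t. _ * t"]
        if_distrib[of "\<lambda>t. t * _"] cong: if_cong)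
  have "lie_bracket (\<lambda>_. axis i 1) (\<lambda>_. axis j 1) = (\<lambda>_. 0 :: real^'n)"
    by (simp add: lie_bracket_def fun_eq_iff)
  then have zero: "levi_civita G (lie_bracket (\<lambda>_. axis i 1) (\<lambda>_. axis j 1)) (\<lambda>_. axis k 1) x = 0"
    by (simp add: levi_civita_def vec_eq_iff)
  show ?thesis
    unfolding curvature_comp_def curvature_def nabla nabla2 zero
    by (simp add: inner_vec_def matrix_vector_mult_basis column_def sum_subtractf add_diff_add)
qed


section \<open>The rank estimate\<close>

text \<open>As \<open>u\<close> is real, the real and imaginary parts of its \<open>d_z\<close>
  derivative recover the derivatives along both real directions of each complex coordinate. The
  factorisation makes all of these real combinations of the two fixed vectors \<open>Re c\<close>
  and \<open>Im c\<close>.\<close>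

lemma dim_range_frechet_derivative_le_2:
  fixes u :: "complex^'m \<Rightarrow> real^'n"
  assumes u: "u differentiable (at z)"
    and cr: "\<And>i \<gamma>. d_z \<gamma> (\<lambda>y. complex_of_real (u y $ i)) z = c i * r \<gamma>"
  shows "dim (range (frechet_derivative u (at z))) \<le> 2"
proof -
  let ?L = "frechet_derivative u (at z)"
  define a b :: "real^'n" where "a = (\<chi> i. Re (c i))" and "b = (\<chi> i. Im (c i))"
  have lin: "linear ?L"
    using u by (rule linear_frechet_derivative)
  have eq: "(complex_of_real (?L (axis \<gamma> 1) $ i) - \<i> * complex_of_real (?L (axis \<gamma> \<i>) $ i)) / 2
      = c i * r \<gamma>" for i \<gamma>
    using cr d_z_component[of u ?L z \<gamma> i] u frechet_derivative_works by metis
  have re: "?L (axis \<gamma> 1) $ i = 2 * Re (c i * r \<gamma>)" for i \<gamma>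
    using arg_cong[OF eq[of \<gamma> i], of Re] by simp
  have im: "?L (axis \<gamma> \<i>) $ i = - 2 * Im (c i * r \<gamma>)" for i \<gamma>
    using arg_cong[OF eq[of \<gamma> i], of Im] by simp
  have 1: "?L (axis \<gamma> 1) = (2 * Re (r \<gamma>)) *\<^sub>R a - (2 * Im (r \<gamma>)) *\<^sub>R b" for \<gamma>
    by (simp add: vec_eq_iff re a_def b_def algebra_simps)
  have 2: "?L (axis \<gamma> \<i>) = (- 2 * Im (r \<gamma>)) *\<^sub>R a - (2 * Re (r \<gamma>)) *\<^sub>R b" for \<gamma>
    by (simp add: vec_eq_iff im a_def b_def algebra_simps)
  have base: "a \<in> span {a, b}" "b \<in> span {a, b}"
    by (simp_all add: span_base)
  have in_span: "?L (axis \<gamma> 1) \<in> span {a, b}" "?L (axis \<gamma> \<i>) \<in> span {a, b}" for \<gamma>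
    unfolding 1 2 by (intro span_diff span_scale base)+
  have "?L v \<in> span {a, b}" for v
  proof -
    \<comment> \<open>Expansion of \<open>v\<close> in the real basis formed by the vectors
      \<open>axis \<gamma> 1\<close> and \<open>axis \<gamma> \<i>\<close>, as the derivative is
      only real-linear.\<close>
    have "v = (\<Sum>\<gamma>\<in>UNIV. Re (v $ \<gamma>) *\<^sub>R axis \<gamma> 1 + Im (v $ \<gamma>) *\<^sub>R axis \<gamma> \<i>)"
    proof (rule vec_eq_iff[THEN iffD2], rule allI)
      fix k
      have "(\<Sum>\<gamma>\<in>UNIV. Re (v $ \<gamma>) *\<^sub>R axis \<gamma> 1 + Im (v $ \<gamma>) *\<^sub>R axis \<gamma> \<i>) $ k
        = (\<Sum>\<gamma>\<in>UNIV. if \<gamma> = k then v $ k else 0)"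
        unfolding sum_component
        by (rule sum.cong) (auto simp: axis_def complex_eq_iff)
      then show "v $ k = (\<Sum>\<gamma>\<in>UNIV. Re (v $ \<gamma>) *\<^sub>R axis \<gamma> 1 + Im (v $ \<gamma>) *\<^sub>R axis \<gamma> \<i>) $ k"
        by simp
    qed
    then have "?L v = ?L (\<Sum>\<gamma>\<in>UNIV. Re (v $ \<gamma>) *\<^sub>R axis \<gamma> 1 + Im (v $ \<gamma>) *\<^sub>R axis \<gamma> \<i>)"
      by (rule arg_cong)
    also have "\<dots> = (\<Sum>\<gamma>\<in>UNIV. Re (v $ \<gamma>) *\<^sub>R ?L (axis \<gamma> 1) + Im (v $ \<gamma>) *\<^sub>R ?L (axis \<gamma> \<i>))"
      by (simp add: linear_sum[OF lin] linear_add[OF lin] linear_scale[OF lin])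
    also have "\<dots> \<in> span {a, b}"
      by (intro span_sum span_add span_scale in_span)
    finally show ?thesis .
  qed
  then have "dim (range ?L) \<le> card {a, b}"
    by (intro dim_le_card) auto
  also have "\<dots> \<le> 2"
    by (simp add: card_insert_if)
  finally show ?thesis .
qed

section \<open>Vanishing curvature terms and the rank bound in a pair of charts\<close>

lemma sum_swap_3_1:
  "(\<Sum>i\<in>A. \<Sum>j\<in>B. \<Sum>k\<in>C. \<Sum>l\<in>D. h i j k l) = (\<Sum>l\<in>D. \<Sum>i\<in>A. \<Sum>j\<in>B. \<Sum>k\<in>C. h i j k l)"
  by (simp only: sum.swap[of _ D C] sum.swap[of _ D B] sum.swap[of _ D A])

lemma sum_swap_3_3:
  "(\<Sum>i\<in>A. \<Sum>j\<in>B. \<Sum>k\<in>C. \<Sum>l\<in>D. \<Sum>m\<in>E. \<Sum>n\<in>F. h i j k l m n)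
    = (\<Sum>l\<in>D. \<Sum>m\<in>E. \<Sum>n\<in>F. \<Sum>i\<in>A. \<Sum>j\<in>B. \<Sum>k\<in>C. h i j k l m n)"
  by (simp only: sum.swap[of _ D C] sum.swap[of _ D B] sum.swap[of _ D A]
      sum.swap[of _ E C] sum.swap[of _ E B] sum.swap[of _ E A]
      sum.swap[of _ F C] sum.swap[of _ F B] sum.swap[of _ F A])

text \<open>For fixed \<open>\<gamma>\<close> the field with components
  \<open>d_zbar \<gamma> (F i)\<close> plays the role of \<open>Z\<close> in
  \<open>parallel_field_curvature_zero\<close>. Contracting the resulting identity with the metric
  lowers its free index to \<open>l\<close>.\<close>

lemma pluriharmonic_curvature_zero:
  fixes u :: "complex^'m \<Rightarrow> real^'n" and G :: "real^'n \<Rightarrow> real^'n^'n"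
  defines "F \<equiv> \<lambda>i z. complex_of_real (u z $ i)"
  assumes S: "open S" "z \<in> S" and T: "open T" and uT: "\<And>y. y \<in> S \<Longrightarrow> u y \<in> T"
    and u: "Ck_on 3 S u" and G: "Ck_on 2 T G"
    and sym: "\<And>x. x \<in> T \<Longrightarrow> transpose (G x) = G x" and nz: "\<And>x. x \<in> T \<Longrightarrow> det (G x) \<noteq> 0"
    and ph: "\<And>y \<alpha> \<beta> i. y \<in> S \<Longrightarrow> d_z \<alpha> (d_zbar \<beta> (F i)) y +
      (\<Sum>j\<in>UNIV. \<Sum>k\<in>UNIV. complex_of_real (christoffel G i j k (u y))
        * d_zbar \<beta> (F j) y * d_z \<alpha> (F k) y) = 0"
  shows "(\<Sum>i\<in>UNIV. \<Sum>j\<in>UNIV. \<Sum>k\<in>UNIV. complex_of_real (curvature_comp G i j k l (u z))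
      * d_z \<alpha> (F i) z * d_z \<beta> (F j) z * d_zbar \<gamma> (F k) z) = 0"
proof -
  let ?\<Gamma> = "christoffel G"
  \<comment> \<open>Three derivatives are needed: \<open>parallel_field_curvature_zero\<close> wants
    a field of class C^2, and that field is already a first derivative of \<open>F\<close>.\<close>
  have F3: "Ck_on (Suc 2) S (F i)" for i
    unfolding F_def
    by (rule Ck_on_bounded_linear_compose[OF S(1) bounded_linear_compose[OF bounded_linear_of_real
            bounded_linear_vec_nth]]) (use u in \<open>simp add: eval_nat_numeral\<close>)
  have F2: "Ck_on 2 S (F i)" for i
    using F3 by (rule Ck_on_Suc_imp_Ck_on)
  have ud: "u differentiable (at z)"
    using u S by (simp add: eval_nat_numeral)
  have \<Gamma>d: "?\<Gamma> i j k differentiable (at (u z))" for i j k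
    by (rule differentiable_christoffel[OF T uT[OF S(2)] G nz])
  have G1: "Ck_on 1 T G"
    by (rule Ck_on_Suc_imp_Ck_on) (use G in \<open>simp add: numeral_2_eq_2\<close>)
  have \<Gamma>sym: "?\<Gamma> i j k (u y) = ?\<Gamma> i k j (u y)" if "y \<in> S" for i j k y
    by (rule christoffel_commute[OF T uT[OF that] G1 sym])
  have parallel: "d_z \<alpha> (d_zbar \<gamma> (F i)) y = - (\<Sum>j\<in>UNIV. \<Sum>k\<in>UNIV.
      complex_of_real (?\<Gamma> i j k (u y)) * d_z \<alpha> (F j) y * d_zbar \<gamma> (F k) y)"
    if "y \<in> S" for \<alpha> \<gamma> i y
  proof -
    have "d_z \<alpha> (d_zbar \<gamma> (F i)) y = - (\<Sum>j\<in>UNIV. \<Sum>k\<in>UNIV.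
        complex_of_real (?\<Gamma> i j k (u y)) * d_zbar \<gamma> (F j) y * d_z \<alpha> (F k) y)"
      using ph[OF that] by (simp add: eq_neg_iff_add_eq_0)
    \<comment> \<open>In the pluri-harmonic equation the first lower index of
      \<open>\<Gamma>\<close> belongs to \<open>d_zbar\<close>, but a covariant derivative needs the
      direction of differentiation there. Symmetry of the lower indices exchanges the two.\<close>
    also have "\<dots> = - (\<Sum>j\<in>UNIV. \<Sum>k\<in>UNIV.
        complex_of_real (?\<Gamma> i j k (u y)) * d_z \<alpha> (F j) y * d_zbar \<gamma> (F k) y)"
      by (subst sum.swap) (simp add: \<Gamma>sym[OF that, of i] mult_ac)
    finally show ?thesis .
  qed
  define R where "R = (\<lambda>i j k s. partial i (?\<Gamma> s j k) (u z) - partial j (?\<Gamma> s i k) (u z)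
      + (\<Sum>t\<in>UNIV. ?\<Gamma> s i t (u z) * ?\<Gamma> t j k (u z) - ?\<Gamma> s j t (u z) * ?\<Gamma> t i k (u z)))"
  have R0: "(\<Sum>i\<in>UNIV. \<Sum>j\<in>UNIV. \<Sum>k\<in>UNIV. complex_of_real (R i j k s)
      * d_z \<alpha> (F i) z * d_z \<beta> (F j) z * d_zbar \<gamma> (F k) z) = 0" for s
    unfolding R_def F_def
    by (rule parallel_field_curvature_zero[OF S ud F2[unfolded F_def]
          Ck_on_d_z_d_zbar(2)[OF S(1) F3[unfolded F_def]] \<Gamma>d parallel[unfolded F_def]])
  have cc: "curvature_comp G i j k l (u z) = (\<Sum>s\<in>UNIV. R i j k s * G (u z) $ s $ l)" for i j k
    unfolding R_def by (rule curvature_comp_eq[OF \<Gamma>d])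
  have "(\<Sum>i\<in>UNIV. \<Sum>j\<in>UNIV. \<Sum>k\<in>UNIV. complex_of_real (curvature_comp G i j k l (u z))
      * d_z \<alpha> (F i) z * d_z \<beta> (F j) z * d_zbar \<gamma> (F k) z)
    = (\<Sum>i\<in>UNIV. \<Sum>j\<in>UNIV. \<Sum>k\<in>UNIV. \<Sum>s\<in>UNIV. complex_of_real (G (u z) $ s $ l)
      * (complex_of_real (R i j k s) * d_z \<alpha> (F i) z * d_z \<beta> (F j) z * d_zbar \<gamma> (F k) z))"
    by (simp add: cc sum_distrib_right) (simp add: mult_ac)
  also have "\<dots> = (\<Sum>s\<in>UNIV. complex_of_real (G (u z) $ s $ l) * (\<Sum>i\<in>UNIV. \<Sum>j\<in>UNIV. \<Sum>k\<in>UNIV.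
      complex_of_real (R i j k s) * d_z \<alpha> (F i) z * d_z \<beta> (F j) z * d_zbar \<gamma> (F k) z))"
    by (subst sum_swap_3_1) (simp add: sum_distrib_left)
  finally show ?thesis
    using R0 by simp
qed

text \<open>Non-degeneracy is tested on the Gram matrix of the \<open>d_z\<close> derivatives. Its
  rank bound makes the matrix of these derivatives a product \<open>c i * r \<gamma>\<close>, which
  confines the image of the real differential to a plane.\<close>

lemma rank_le_2_in_chart:
  fixes u :: "complex^'m \<Rightarrow> real^'n" and G :: "real^'n \<Rightarrow> real^'n^'n"
  defines "F \<equiv> \<lambda>i z. complex_of_real (u z $ i)"
  assumes S: "open S" "z \<in> S" and T: "open T" and uT: "\<And>y. y \<in> S \<Longrightarrow> u y \<in> T"
    and u: "smooth_on S u" and G: "smooth_on T G"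
    and sym: "\<And>x. x \<in> T \<Longrightarrow> transpose (G x) = G x"
    and pos: "\<And>x v. x \<in> T \<Longrightarrow> v \<noteq> 0 \<Longrightarrow> v \<bullet> (G x *v v) > 0"
    and ph: "\<And>y \<alpha> \<beta> i. y \<in> S \<Longrightarrow> d_z \<alpha> (d_zbar \<beta> (F i)) y +
      (\<Sum>j\<in>UNIV. \<Sum>k\<in>UNIV. complex_of_real (christoffel G i j k (u y))
        * d_zbar \<beta> (F j) y * d_z \<alpha> (F k) y) = 0"
    and nondeg: "\<And>A::complex^'n^'n. hermitian_psd A \<Longrightarrow>
         (\<Sum>i\<in>UNIV. \<Sum>j\<in>UNIV. \<Sum>k\<in>UNIV. \<Sum>l\<in>UNIV.
            complex_of_real (curvature_comp G i j k l (u z)) * A $ i $ l * A $ j $ k) = 0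
         \<Longrightarrow> rank A \<le> 1"
  shows "dim (range (frechet_derivative u (at z))) \<le> 2"
proof -
  have u3: "Ck_on 3 S u" and G2: "Ck_on 2 T G"
    using u G by (auto simp: smooth_on_def)
  have ud: "u differentiable (at z)"
    using u3 S by (simp add: eval_nat_numeral)
  define P where "P = (\<lambda>i \<gamma>. d_z \<gamma> (F i) z)"
  have real: "Im (frechet_derivative (F i) (at z) v) = 0" for i v
  proof -
    have "((\<lambda>y. complex_of_real (u y $ i)) has_derivative
        (\<lambda>v. complex_of_real (frechet_derivative u (at z) v $ i))) (at z)"
      using ud frechet_derivative_works
      by (intro has_derivative_of_real bounded_linear.has_derivative[OF bounded_linear_vec_nth]) blast
    from frechet_derivative_at[OF this, symmetric] show ?thesis
      by (simp add: F_def)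
  qed
  \<comment> \<open>Conjugation exchanges the two Wirtinger derivatives because the components of
    \<open>u\<close> are real.\<close>
  have cnjP: "d_zbar \<gamma> (F i) z = cnj (P i \<gamma>)" for i \<gamma>
    unfolding P_def d_z_def d_zbar_def by (simp add: complex_eq_iff real)
  define A :: "complex^'n^'n" where "A = (\<chi> i j. \<Sum>\<gamma>\<in>UNIV. P i \<gamma> * cnj (P j \<gamma>))"
  let ?R = "\<lambda>i j k l. complex_of_real (curvature_comp G i j k l (u z))"
  have R0: "(\<Sum>i\<in>UNIV. \<Sum>j\<in>UNIV. \<Sum>k\<in>UNIV. ?R i j k l * P i \<gamma> * P j \<delta> * cnj (P k \<delta>)) = 0" for l \<gamma> \<delta>
    using pluriharmonic_curvature_zero[OF S T uT u3 G2 sym det_nonzero_of_positive_definite[OF pos]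
        ph[unfolded F_def], of l \<gamma> \<delta> \<delta>]
    unfolding cnjP[unfolded F_def] P_def F_def by simp
  \<comment> \<open>The first factor \<open>A\<close> pairs \<open>i\<close> with \<open>l\<close>
    through \<open>\<gamma>\<close>, the second pairs \<open>j\<close> with \<open>k\<close> through
    \<open>\<delta>\<close>. For fixed \<open>l\<close>, \<open>\<gamma>\<close> and
    \<open>\<delta>\<close>, the sum over \<open>i\<close>, \<open>j\<close> and \<open>k\<close> is
    then a multiple of the expression in \<open>R0\<close>.\<close>
  have AA: "?R i j k l * A $ i $ l * A $ j $ k = (\<Sum>\<gamma>\<in>UNIV. \<Sum>\<delta>\<in>UNIV.
      cnj (P l \<gamma>) * (?R i j k l * P i \<gamma> * P j \<delta> * cnj (P k \<delta>)))" for i j k l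
  proof -
    have "A $ i $ l * A $ j $ k
        = (\<Sum>\<gamma>\<in>UNIV. \<Sum>\<delta>\<in>UNIV. P i \<gamma> * cnj (P l \<gamma>) * (P j \<delta> * cnj (P k \<delta>)))"
      by (simp add: A_def sum_product)
    then show ?thesis
      by (simp add: mult.assoc sum_distrib_left) (simp add: mult_ac)
  qed
  have "(\<Sum>i\<in>UNIV. \<Sum>j\<in>UNIV. \<Sum>k\<in>UNIV. \<Sum>l\<in>UNIV. ?R i j k l * A $ i $ l * A $ j $ k)
    = (\<Sum>i\<in>UNIV. \<Sum>j\<in>UNIV. \<Sum>k\<in>UNIV. \<Sum>l\<in>UNIV. \<Sum>\<gamma>\<in>UNIV. \<Sum>\<delta>\<in>UNIV.
        cnj (P l \<gamma>) * (?R i j k l * P i \<gamma> * P j \<delta> * cnj (P k \<delta>)))"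
    unfolding AA ..
  also have "\<dots> = (\<Sum>l\<in>UNIV. \<Sum>\<gamma>\<in>UNIV. \<Sum>\<delta>\<in>UNIV. \<Sum>i\<in>UNIV. \<Sum>j\<in>UNIV. \<Sum>k\<in>UNIV.
        cnj (P l \<gamma>) * (?R i j k l * P i \<gamma> * P j \<delta> * cnj (P k \<delta>)))"
    by (rule sum_swap_3_3)
  also have "\<dots> = 0"
    using R0 by (simp add: sum_distrib_left[symmetric])
  finally have "rank A \<le> 1"
    by (intro nondeg) (simp_all add: A_def hermitian_psd_gram)
  then obtain c r where "\<And>i \<gamma>. P i \<gamma> = c i * r \<gamma>"
    using gram_rank_le_1_factor[of P] unfolding A_def by blast
  then show ?thesis
    using dim_range_frechet_derivative_le_2[OF ud] by (simp add: P_def F_def)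
qed

section \<open>Passage from charts to the manifolds\<close>

lemma chart_inj_on:
  assumes "is_chart X (U, \<phi>)"
  shows "inj_on \<phi> U"
  using assms homeomorphic_imp_injective_map openin_subset
  unfolding is_chart_def by (force simp: topspace_subtopology Int_absorb1)

text \<open>Continuity of \<open>f\<close> makes the preimage of the target chart domain open in
  \<open>U\<close>, and the chart map is open onto an image that is itself open in the coordinate
  space.\<close>

lemma open_coord_dom:
  assumes c: "is_chart X c" and d: "is_chart Y d" and f: "continuous_map X Y f"
  shows "open (coord_dom c d f)"
proof -
  obtain U \<phi> V \<psi> where cd: "c = (U, \<phi>)" "d = (V, \<psi>)"
    by fastforce
  have U: "openin X U" "open (\<phi> ` U)" "homeomorphic_map (subtopology X U) (top_of_set (\<phi> ` U)) \<phi>"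
    using c by (auto simp: cd is_chart_def)
  have V: "openin Y V"
    using d by (auto simp: cd is_chart_def)
  \<comment> \<open>The preimage in \<open>coord_dom\<close> is taken in the whole type, whereas
    continuity speaks about the preimage in \<open>topspace X\<close>; inside \<open>U\<close> they
    agree.\<close>
  have "U \<inter> f -` V = U \<inter> {x \<in> topspace X. f x \<in> V}"
    using openin_subset[OF U(1)] by auto
  then have "openin (subtopology X U) (U \<inter> f -` V)"
    using openin_continuous_map_preimage[OF f V] by (simp add: openin_subtopology_Int2)
  then have "openin (top_of_set (\<phi> ` U)) (\<phi> ` (U \<inter> f -` V))"
    using U(3) homeomorphic_imp_open_map open_map_def by blast
  then show ?thesis
    using U(2) openin_open_trans by (auto simp: cd coord_dom_def)
qed

theorem theorem1p6:
  fixes X :: "'x topology" and A :: "('x, complex^'m) chart set"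
    and Y :: "'y topology" and B :: "('y, real^'n) chart set" and g :: "('y, 'n) metric"
    and f :: "'x \<Rightarrow> 'y" and p :: 'x
  assumes "complex_manifold X A" and "compact_space X"
    and "riemannian_manifold Y B g"
    and "pluriharmonic X A Y B g f"
    and "p \<in> topspace X"
    and "hermitian_nondegenerate_at B g (f p)"
  shows "\<forall>c\<in>A. \<forall>d\<in>B. p \<in> fst c \<longrightarrow> f p \<in> fst d \<longrightarrow> rank_differential c d f p \<le> 2"
proof (intro ballI impI)
  fix c d
  assume c: "c \<in> A" and d: "d \<in> B" and pc: "p \<in> fst c" and fpd: "f p \<in> fst d"
  obtain U \<phi> V \<psi> where cd: "c = (U, \<phi>)" "d = (V, \<psi>)"
    by fastforce
  have p: "p \<in> U" "f p \<in> V"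
    using pc fpd by (auto simp: cd)
  have chart: "is_chart X c" "is_chart Y d"
    using assms(1,3) c d
    by (auto simp: complex_manifold_def riemannian_manifold_def smooth_manifold_def is_atlas_def)
  have inv: "inv_into U \<phi> (\<phi> x) = x" if "x \<in> U" for x
    using chart(1) chart_inj_on that unfolding cd by (metis inv_into_f_f)
  have f: "smooth_map X A Y B f"
    using assms(4) by (simp add: pluriharmonic_def)
  have metric: "smooth_on (\<psi> ` V) (g d)"
    "\<forall>x\<in>\<psi> ` V. transpose (g d x) = g d x \<and> (\<forall>v. v \<noteq> 0 \<longrightarrow> v \<bullet> (g d x *v v) > 0)"
    using assms(3) d by (auto simp: riemannian_manifold_def riemannian_metric_def cd)
  have up: "coord_rep c d f (\<phi> p) = \<psi> (f p)"
    using inv p by (simp add: coord_rep_def cd)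
  have nd: "\<forall>A::complex^'n^'n. hermitian_psd A \<longrightarrow>
      (\<Sum>i\<in>UNIV. \<Sum>j\<in>UNIV. \<Sum>k\<in>UNIV. \<Sum>l\<in>UNIV.
        complex_of_real (curvature_comp (g d) i j k l (\<psi> (f p))) * A $ i $ l * A $ j $ k) = 0
      \<longrightarrow> rank A \<le> 1"
    using bspec[OF assms(6)[unfolded hermitian_nondegenerate_at_def] d] p unfolding cd prod.case
    by blast
  have "dim (range (frechet_derivative (coord_rep c d f) (at (\<phi> p)))) \<le> 2"
  \<comment> \<open>The pluri-harmonic equation is required on a full neighbourhood, since it gets
    differentiated; the open set \<open>coord_dom c d f\<close> supplies one. Curvature
    non-degeneracy enters at the coordinates of \<open>f p\<close>, identified by
    \<open>up\<close>.\<close>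
  proof (rule rank_le_2_in_chart[where S = "coord_dom c d f" and T = "\<psi> ` V" and G = "g d"])
    show "open (coord_dom c d f)"
      using open_coord_dom[OF chart] f unfolding smooth_map_def by blast
    show "\<phi> p \<in> coord_dom c d f"
      using p by (auto simp: coord_dom_def cd)
    show "open (\<psi> ` V)"
      using chart by (auto simp: is_chart_def cd)
    show "coord_rep c d f y \<in> \<psi> ` V" if "y \<in> coord_dom c d f" for y
      using that inv by (auto simp: coord_dom_def coord_rep_def cd)
    show "smooth_on (coord_dom c d f) (coord_rep c d f)"
      using f c d by (auto simp: smooth_map_def)
  next
    fix y \<alpha> \<beta> i
    assume "y \<in> coord_dom c d f"
    then show "d_z \<alpha> (d_zbar \<beta> (\<lambda>z. complex_of_real (coord_rep c d f z $ i))) y +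
        (\<Sum>j\<in>UNIV. \<Sum>k\<in>UNIV. complex_of_real (christoffel (g d) i j k (coord_rep c d f y)) *
          d_zbar \<beta> (\<lambda>z. complex_of_real (coord_rep c d f z $ j)) y *
          d_z \<alpha> (\<lambda>z. complex_of_real (coord_rep c d f z $ k)) y) = 0"
      using assms(4) c d unfolding pluriharmonic_def Let_def by blast
  next
    fix A :: "complex^'n^'n"
    assume "hermitian_psd A" "(\<Sum>i\<in>UNIV. \<Sum>j\<in>UNIV. \<Sum>k\<in>UNIV. \<Sum>l\<in>UNIV.
        complex_of_real (curvature_comp (g d) i j k l (coord_rep c d f (\<phi> p))) * A $ i $ l * A $ j $ k) = 0"
    then show "rank A \<le> 1"
      using nd by (simp add: up)
  qed (use metric in auto)
  then show "rank_differential c d f p \<le> 2"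
    by (simp add: rank_differential_def cd)
qed

end
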